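(* Let $\mathcal{C}$ be a finite connected acyclic category. The following are equivalent: (1) $\mathrm{dcat}(\mathcal{C})=0$; (2) every functor $X\colon\mathcal{C}\to\mathbf{Set}$ with $X(c)\neq\varnothing$ for every object $c\in\mathcal{C}$ admits a global section, i.e. the projection $\pi_X\colon\int^{\mathcal{C}}X\to\mathcal{C}$ has a section (a functor $s\colon\mathcal{C}\to\int^{\mathcal{C}}X$ with $\pi_Xs=1_{\mathcal{C}}$).
   Context: A category is finite if it has finitely many morphisms; connected if it is non-empty and any two objects are joined by a finite zigzag of morphisms; acyclic if every endomorphism is an identity and, for distinct objects $c,d$, the existence of a morphism $c\to d$ implies that there is no morphism $d\to c$. For $X\colon\mathcal{C}\to\mathbf{Set}$, the category of elements $\int^{\mathcal{C}}X$ has objects $(c,x)$ with $x\in X(c)$; a morphism $(c,x)\to(d,y)$ is a morphism $f\colon c\to d$ in $\mathcal{C}$ with $X(f)(x)=y$; $\pi_X$ is the projection $(c,x)\mapsto c$. A cover of a category $\mathcal{C}$ is a family of (not necessarily full) subcategories such that every morphism of $\mathcal{C}$ belongs to at least one of them. The directed Lusternik–Schnirelmann category $\mathrm{dcat}(\mathcal{C})$ is the least integer $n\geq0$ such that $\mathcal{C}$ admits a cover $\{\mathcal{U}_0,\dots,\mathcal{U}_n\}$ with, for each $i$, an object $c_i\in\mathcal{C}$ and a natural transformation $\overline{c_i}\Rightarrow\iota_i$, where $\overline{c_i}\colon\mathcal{U}_i\to\mathcal{C}$ is the constant functor at $c_i$ and $\iota_i\colon\mathcal{U}_i\hookrightarrow\mathcal{C}$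 is the inclusion; $\mathrm{dcat}(\mathcal{C})=\infty$ if no such finite cover exists. *)

theory Defs
  imports "HOL-Library.FuncSet" "HOL-Library.Extended_Nat"
begin

record ('o, 'm) cat =
  Obj :: "'o set"
  Mor :: "'m set"
  Dom :: "'m \<Rightarrow> 'o"
  Cod :: "'m \<Rightarrow> 'o"
  Ide :: "'o \<Rightarrow> 'm"
  Cmp :: "'m \<Rightarrow> 'm \<Rightarrow> 'm"  \<comment> \<open>\<^term>\<open>Cmp C g f\<close> is g after f\<close>

definition hom :: "('o, 'm) cat \<Rightarrow> 'o \<Rightarrow> 'o \<Rightarrow> 'm set" where
  "hom C a b = {f \<in> Mor C. Dom C f = a \<and> Cod C f = b}"

locale category =
  fixes C :: "('o, 'm) cat"
  assumes Dom_in_Obj: "f \<in> Mor C \<Longrightarrow> Dom C f \<in> Obj C"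
    and Cod_in_Obj: "f \<in> Mor C \<Longrightarrow> Cod C f \<in> Obj C"
    and Ide_in_hom: "a \<in> Obj C \<Longrightarrow> Ide C a \<in> hom C a a"
    and Cmp_in_hom: "f \<in> hom C a b \<Longrightarrow> g \<in> hom C b c \<Longrightarrow> Cmp C g f \<in> hom C a c"
    and Cmp_Ide_left: "f \<in> hom C a b \<Longrightarrow> Cmp C (Ide C b) f = f"
    and Cmp_Ide_right: "f \<in> hom C a b \<Longrightarrow> Cmp C f (Ide C a) = f"
    and Cmp_assoc: "f \<in> hom C a b \<Longrightarrow> g \<in> hom C b c \<Longrightarrow> h \<in> hom C c d \<Longrightarrow>
      Cmp C h (Cmp C g f) = Cmp C (Cmp C h g) f"

definition finite_cat :: "('o, 'm) cat \<Rightarrow> bool" where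
  "finite_cat C \<longleftrightarrow> finite (Mor C)"

definition arrow_rel :: "('o, 'm) cat \<Rightarrow> 'o rel" where
  "arrow_rel C = {(a, b). hom C a b \<noteq> {}}"

definition connected_cat :: "('o, 'm) cat \<Rightarrow> bool" where
  "connected_cat C \<longleftrightarrow> Obj C \<noteq> {} \<and>
    (\<forall>a\<in>Obj C. \<forall>b\<in>Obj C. (a, b) \<in> (arrow_rel C \<union> (arrow_rel C)\<inverse>)\<^sup>*)"

definition acyclic_cat :: "('o, 'm) cat \<Rightarrow> bool" where
  "acyclic_cat C \<longleftrightarrow>
    (\<forall>a\<in>Obj C. \<forall>f\<in>hom C a a. f = Ide C a) \<and>
    (\<forall>a\<in>Obj C. \<forall>b\<in>Obj C. a \<noteq> b \<longrightarrow> hom C a b \<noteq> {} \<longrightarrow> hom C b a = {})"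

record ('o1, 'm1, 'o2, 'm2) func =
  ob :: "'o1 \<Rightarrow> 'o2"
  ar :: "'m1 \<Rightarrow> 'm2"

locale is_functor = C: category C + D: category D
  for C :: "('o1, 'm1) cat" and D :: "('o2, 'm2) cat" +
  fixes F :: "('o1, 'm1, 'o2, 'm2) func"
  assumes ob_in_Obj: "a \<in> Obj C \<Longrightarrow> ob F a \<in> Obj D"
    and ar_in_hom: "f \<in> hom C a b \<Longrightarrow> ar F f \<in> hom D (ob F a) (ob F b)"
    and ar_Ide: "a \<in> Obj C \<Longrightarrow> ar F (Ide C a) = Ide D (ob F a)"
    and ar_Cmp: "f \<in> hom C a b \<Longrightarrow> g \<in> hom C b c \<Longrightarrow>
      ar F (Cmp C g f) = Cmp D (ar F g) (ar F f)"

definition id_func :: "('o, 'm, 'o, 'm) func" where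
  "id_func = \<lparr>ob = (\<lambda>a. a), ar = (\<lambda>f. f)\<rparr>"

definition comp_func ::
    "('o2, 'm2, 'o3, 'm3) func \<Rightarrow> ('o1, 'm1, 'o2, 'm2) func \<Rightarrow> ('o1, 'm1, 'o3, 'm3) func" where
  "comp_func G F = \<lparr>ob = ob G \<circ> ob F, ar = ar G \<circ> ar F\<rparr>"

definition const_func :: "('o2, 'm2) cat \<Rightarrow> 'o2 \<Rightarrow> ('o1, 'm1, 'o2, 'm2) func" where
  "const_func D d = \<lparr>ob = (\<lambda>_. d), ar = (\<lambda>_. Ide D d)\<rparr>"

text \<open>The values of a functor outside its source category are irrelevant, so functors with
  source \<^term>\<open>C\<close> are compared on the objects and morphisms of \<^term>\<open>C\<close> only.\<close>

definition func_eq_on ::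
    "('o1, 'm1) cat \<Rightarrow> ('o1, 'm1, 'o2, 'm2) func \<Rightarrow> ('o1, 'm1, 'o2, 'm2) func \<Rightarrow> bool" where
  "func_eq_on C F G \<longleftrightarrow> (\<forall>a\<in>Obj C. ob F a = ob G a) \<and> (\<forall>f\<in>Mor C. ar F f = ar G f)"

locale natural_transformation = F: is_functor C D F + G: is_functor C D G
  for C :: "('o1, 'm1) cat" and D :: "('o2, 'm2) cat" and F G +
  fixes \<tau> :: "'o1 \<Rightarrow> 'm2"
  assumes component: "a \<in> Obj C \<Longrightarrow> \<tau> a \<in> hom D (ob F a) (ob G a)"
    and naturality: "f \<in> hom C a b \<Longrightarrow> Cmp D (ar G f) (\<tau> a) = Cmp D (\<tau> b) (ar F f)"

definition subcategory :: "('o, 'm) cat \<Rightarrow> ('o, 'm) cat \<Rightarrow> bool" where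
  "subcategory U C \<longleftrightarrow> category U \<and> Obj U \<subseteq> Obj C \<and> Mor U \<subseteq> Mor C \<and>
    (\<forall>f\<in>Mor U. Dom U f = Dom C f \<and> Cod U f = Cod C f) \<and>
    (\<forall>a\<in>Obj U. Ide U a = Ide C a) \<and>
    (\<forall>f\<in>Mor U. \<forall>g\<in>Mor U. Cod U f = Dom U g \<longrightarrow> Cmp U g f = Cmp C g f)"

text \<open>The inclusion of a subcategory is \<^const>\<open>id_func\<close>, regarded as a functor from the
  subcategory to the ambient category.\<close>

definition is_cover :: "('o, 'm) cat \<Rightarrow> 'i set \<Rightarrow> ('i \<Rightarrow> ('o, 'm) cat) \<Rightarrow> bool" where
  "is_cover C I U \<longleftrightarrow> (\<forall>i\<in>I. subcategory (U i) C) \<and> (\<forall>f\<in>Mor C. \<exists>i\<in>I. f \<in> Mor (U i))"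

definition dcat_le :: "('o, 'm) cat \<Rightarrow> nat \<Rightarrow> bool" where
  "dcat_le C n \<longleftrightarrow> (\<exists>U :: nat \<Rightarrow> ('o, 'm) cat. is_cover C {0..n} U \<and>
    (\<forall>i\<in>{0..n}. \<exists>c\<in>Obj C. \<exists>\<tau>. natural_transformation (U i) C (const_func C c) id_func \<tau>))"

text \<open>In \<^typ>\<open>enat\<close> the infimum of the empty set is \<open>\<infinity>\<close>.\<close>

definition dcat :: "('o, 'm) cat \<Rightarrow> enat" where
  "dcat C = Inf {enat n | n. dcat_le C n}"

text \<open>Sets are sets of elements of the type \<^typ>\<open>'u\<close>, which plays the role of a universe; every
  set embeds into a suitable choice of it. Maps are extensional functions that carry their source
  and target.\<close>

datatype 'u set_map = Set_Map (source: "'u set") (target: "'u set") (app: "'u \<Rightarrow> 'u")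

definition Set_cat :: "('u set, 'u set_map) cat" where
  "Set_cat = \<lparr>
    Obj = UNIV,
    Mor = {\<phi>. app \<phi> \<in> source \<phi> \<rightarrow>\<^sub>E target \<phi>},
    Dom = source,
    Cod = target,
    Ide = (\<lambda>A. Set_Map A A (\<lambda>x\<in>A. x)),
    Cmp = (\<lambda>\<psi> \<phi>. Set_Map (source \<phi>) (target \<psi>) (\<lambda>x\<in>source \<phi>. app \<psi> (app \<phi> x)))\<rparr>"

text \<open>A morphism of the category of elements is recorded together with its endpoints.\<close>

definition elements :: "('o, 'm) cat \<Rightarrow> ('o, 'm, 'u set, 'u set_map) func \<Rightarrow>
    ('o \<times> 'u, ('o \<times> 'u) \<times> 'm \<times> ('o \<times> 'u)) cat" where
  "elements C X = \<lparr>
    Obj = {(c, x). c \<in> Obj C \<and> x \<in> ob X c},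
    Mor = {((c, x), f, (d, y)) | c x f d y.
      c \<in> Obj C \<and> x \<in> ob X c \<and> d \<in> Obj C \<and> y \<in> ob X d \<and> f \<in> hom C c d \<and> app (ar X f) x = y},
    Dom = (\<lambda>(p, f, q). p),
    Cod = (\<lambda>(p, f, q). q),
    Ide = (\<lambda>(c, x). ((c, x), Ide C c, (c, x))),
    Cmp = (\<lambda>(p', g, q') (p, f, q). (p, Cmp C g f, q'))\<rparr>"

definition elements_proj :: "('o \<times> 'u, ('o \<times> 'u) \<times> 'm \<times> ('o \<times> 'u), 'o, 'm) func" where
  "elements_proj = \<lparr>ob = fst, ar = (\<lambda>(p, f, q). f)\<rparr>"

definition has_global_section ::
    "('o, 'm) cat \<Rightarrow> ('o, 'm, 'u set, 'u set_map) func \<Rightarrow> bool" where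
  "has_global_section C X \<longleftrightarrow> (\<exists>s. is_functor C (elements C X) s \<and>
    func_eq_on C (comp_func elements_proj s) id_func)"

lemma category_Set_cat: "category (Set_cat :: ('u set, 'u set_map) cat)"
  by unfold_locales
    (auto simp: Set_cat_def hom_def PiE_iff extensional_def restrict_def fun_eq_iff
      intro!: set_map.expand)

lemma category_elements:
  assumes "is_functor C Set_cat X"
  shows "category (elements C X)"
proof -
  interpret X: is_functor C Set_cat X by fact
  have ide: "app (ar X (Ide C c)) x = x" if "c \<in> Obj C" "x \<in> ob X c" for c x
    using X.ar_Ide[OF that(1)] that(2) by (simp add: Set_cat_def)
  have cmp: "app (ar X (Cmp C g f)) x = app (ar X g) (app (ar X f) x)"
    if "f \<in> hom C a b" "g \<in> hom C b c" "x \<in> ob X a" for f g a b c x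
    using X.ar_Cmp[OF that(1,2)] X.ar_in_hom[OF that(1)] that(3)
    by (simp add: Set_cat_def hom_def)
  show ?thesis
    by unfold_locales
      (auto simp: elements_def hom_def[of "\<lparr>Obj = _, Mor = _, Dom = _, Cod = _, Ide = _, Cmp = _\<rparr>"]
        ide cmp
        intro: X.C.Ide_in_hom X.C.Cmp_in_hom X.C.Cmp_Ide_left X.C.Cmp_Ide_right X.C.Cmp_assoc)
qed

lemma is_functor_elements_proj:
  assumes "is_functor C Set_cat X"
  shows "is_functor (elements C X) C elements_proj"
proof -
  interpret X: is_functor C Set_cat X by fact
  interpret E: category "elements C X" by (rule category_elements) fact
  show ?thesis
    by unfold_locales (auto simp: elements_proj_def elements_def hom_def)
qed

lemma is_functor_const_func:
  assumes "category C" "category D" "d \<in> Obj D"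
  shows "is_functor C D (const_func D d)"
proof -
  interpret C: category C by fact
  interpret D: category D by fact
  show ?thesis
    using assms(3) D.Ide_in_hom D.Cmp_Ide_left[OF D.Ide_in_hom]
    by unfold_locales (auto simp: const_func_def)
qed

lemma is_functor_inclusion:
  assumes "category C" "subcategory U C"
  shows "is_functor U C id_func"
proof -
  interpret C: category C by fact
  interpret U: category U using assms(2) by (simp add: subcategory_def)
  show ?thesis
    using assms(2) by unfold_locales (auto simp: id_func_def subcategory_def hom_def)
qed

end

theory Submission
  imports Defs
begin

text \<open>Since a cover by one subcategory is the whole category, \<open>dcat C = 0\<close> means that the
  identity functor admits a cone from some object \<open>c\<close>. Pushing a point of \<open>X(c)\<close> forward along the
  cone gives a global section of \<open>X\<close>. Conversely, apply (2) to the coproduct over all objects \<open>c\<close>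
  of the representable functors \<open>hom(c,-)\<close>, whose value at \<open>a\<close> is the set of all morphisms with
  codomain \<open>a\<close>; it contains the identity of \<open>a\<close>. A section chooses \<open>\<tau> a : c a \<rightarrow> a\<close> with
  \<open>f \<circ> \<tau> a = \<tau> b\<close> for all \<open>f : a \<rightarrow> b\<close>; then \<open>c a = c b\<close>, so \<open>c\<close> is constant by connectedness
  and \<open>\<tau>\<close> is a cone.\<close>

section \<open>Cones over the identity functor and the vanishing of \<open>dcat\<close>\<close>

definition id_cone :: "('o, 'm) cat \<Rightarrow> 'o \<Rightarrow> ('o \<Rightarrow> 'm) \<Rightarrow> bool" where
  "id_cone C c \<tau> \<longleftrightarrow> c \<in> Obj C \<and> (\<forall>a\<in>Obj C. \<tau> a \<in> hom C c a) \<and>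
    (\<forall>a b. \<forall>f\<in>hom C a b. Cmp C f (\<tau> a) = \<tau> b)"

lemma dcat_eq_0_iff: "dcat C = 0 \<longleftrightarrow> dcat_le C 0"
proof
  assume "dcat C = 0"
  then have "(0::enat) \<in> {enat n | n. dcat_le C n}"
    \<comment> \<open>The infimum of a non-empty set in \<open>enat\<close> is its least element,
      hence attained; the empty set would give infinity instead of 0.\<close>
    unfolding dcat_def by (metis (lifting) Inf_enat_def LeastI ex_in_conv infinity_ne_i0)
  then show "dcat_le C 0" by (auto simp: zero_enat_def)
next
  assume "dcat_le C 0"
  then have "(0::enat) \<in> {enat n | n. dcat_le C n}" by (auto simp: zero_enat_def)
  then have "dcat C \<le> 0" unfolding dcat_def by (rule Inf_lower)
  then show "dcat C = 0" by simp
qed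

context category
begin

lemma hom_objs:
  assumes "f \<in> hom C a b"
  shows "a \<in> Obj C" "b \<in> Obj C"
  using assms Dom_in_Obj Cod_in_Obj by (auto simp: hom_def)

lemma subcategory_self: "subcategory C C"
  using category_axioms by (simp add: subcategory_def)

text \<open>The constant functor sends every arrow to the identity of \<open>c\<close>, so one side
  of each naturality square disappears by the right unit law.\<close>

lemma natural_transformation_iff_id_cone:
  "c \<in> Obj C \<and> natural_transformation C C (const_func C c) id_func \<tau> \<longleftrightarrow> id_cone C c \<tau>"
proof
  assume l: "c \<in> Obj C \<and> natural_transformation C C (const_func C c) id_func \<tau>"
  then interpret N: natural_transformation C C "const_func C c" id_func \<tau> by blast
  have comp: "\<tau> a \<in> hom C c a" if "a \<in> Obj C" for a
    using N.component[OF that] by (simp add: const_func_def id_func_def)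
  have "Cmp C f (\<tau> a) = \<tau> b" if "f \<in> hom C a b" for a b f
    using N.naturality[OF that] Cmp_Ide_right[OF comp[OF hom_objs(2)[OF that]]]
    by (simp add: const_func_def id_func_def)
  with comp l show "id_cone C c \<tau>" by (simp add: id_cone_def)
next
  assume r: "id_cone C c \<tau>"
  then have c: "c \<in> Obj C" by (simp add: id_cone_def)
  interpret K: is_functor C C "const_func C c"
    by (rule is_functor_const_func[OF category_axioms category_axioms c])
  interpret I: is_functor C C id_func
    by (rule is_functor_inclusion[OF category_axioms subcategory_self])
  have "natural_transformation C C (const_func C c) id_func \<tau>"
  proof
    show "\<tau> a \<in> hom C (ob (const_func C c) a) (ob id_func a)" if "a \<in> Obj C" for a
      using r that by (simp add: id_cone_def const_func_def id_func_def)
    show "Cmp C (ar id_func f) (\<tau> a) = Cmp C (\<tau> b) (ar (const_func C c) f)"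
      if "f \<in> hom C a b" for f a b
      using r that Cmp_Ide_right[of "\<tau> b" c b] hom_objs(2)[OF that]
      by (simp add: id_cone_def const_func_def id_func_def)
  qed
  with c show "c \<in> Obj C \<and> natural_transformation C C (const_func C c) id_func \<tau>" by simp
qed

text \<open>Every object of \<open>C\<close> is the domain of its identity, which lies in
  \<open>Mor U\<close>. The records \<open>U\<close> and \<open>C\<close> may still differ in
  irrelevant values, so only objects and hom-sets are identified.\<close>

lemma wide_full_subcategory:
  assumes "subcategory U C" "Mor C \<subseteq> Mor U"
  shows "Obj U = Obj C" "hom U a b = hom C a b"
proof -
  interpret U: category U using assms(1) by (simp add: subcategory_def)
  have mor: "Mor U = Mor C" and dom: "\<And>f. f \<in> Mor U \<Longrightarrow> Dom U f = Dom C f \<and> Cod U f = Cod C f"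
    using assms by (auto simp: subcategory_def)
  then show "hom U a b = hom C a b" by (auto simp: hom_def)
  have "a \<in> Obj U" if "a \<in> Obj C" for a
    using Ide_in_hom[OF that] mor dom U.Dom_in_Obj by (force simp: hom_def)
  then show "Obj U = Obj C" using assms(1) by (auto simp: subcategory_def)
qed

text \<open>The index set \<open>{0..0}\<close> has one element, so the single member of the cover
  contains all morphisms; conversely \<open>C\<close> covers itself.\<close>

lemma dcat_le_0_iff_id_cone: "dcat_le C 0 \<longleftrightarrow> (\<exists>c \<tau>. id_cone C c \<tau>)"
proof
  assume "dcat_le C 0"
  then obtain U c \<tau> where U: "subcategory U C" "Mor C \<subseteq> Mor U" and c: "c \<in> Obj C"
    and nt: "natural_transformation U C (const_func C c) id_func \<tau>"
    by (fastforce simp: dcat_le_def is_cover_def)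
  interpret K: is_functor C C "const_func C c"
    by (rule is_functor_const_func[OF category_axioms category_axioms c])
  interpret I: is_functor C C id_func
    by (rule is_functor_inclusion[OF category_axioms subcategory_self])
  interpret N: natural_transformation U C "const_func C c" id_func \<tau> by (rule nt)
  \<comment> \<open>The components and squares of \<open>\<tau>\<close> over \<open>U\<close> are
    literally those over \<open>C\<close>, because objects and hom-sets agree.\<close>
  have "natural_transformation C C (const_func C c) id_func \<tau>"
    by unfold_locales (use N.component N.naturality wide_full_subcategory[OF U] in auto)
  with c show "\<exists>c \<tau>. id_cone C c \<tau>" using natural_transformation_iff_id_cone by blast
next
  assume "\<exists>c \<tau>. id_cone C c \<tau>"
  then obtain c \<tau> where "c \<in> Obj C" "natural_transformation C C (const_func C c) id_func \<tau>"
    using natural_transformation_iff_id_cone by blast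
  then show "dcat_le C 0"
    using subcategory_self unfolding dcat_le_def is_cover_def
    by (intro exI[of _ "\<lambda>_. C"]) auto
qed

end

section \<open>Global sections as compatible families of points\<close>

text \<open>A section sends \<open>a\<close> to a pair \<open>(a, t a)\<close>, and its value on
  \<open>f\<close> is forced: a morphism of the category of elements consists of its endpoints and
  \<open>f\<close>. Its existence is exactly the compatibility of \<open>t\<close> with
  \<open>f\<close>.\<close>

lemma has_global_section_iff:
  assumes "is_functor C Set_cat X"
  shows "has_global_section C X \<longleftrightarrow>
    (\<exists>t. (\<forall>a\<in>Obj C. t a \<in> ob X a) \<and> (\<forall>a b. \<forall>f\<in>hom C a b. app (ar X f) (t a) = t b))"
proof -
  interpret X: is_functor C Set_cat X by fact
  interpret E: category "elements C X" by (rule category_elements) fact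
  show ?thesis
  proof
    assume "has_global_section C X"
    then obtain s where s: "is_functor C (elements C X) s"
      and eq: "func_eq_on C (comp_func elements_proj s) id_func"
      by (auto simp: has_global_section_def)
    interpret S: is_functor C "elements C X" s by fact
    have 1: "fst (ob s a) = a" if "a \<in> Obj C" for a
      using eq that by (simp add: func_eq_on_def comp_func_def elements_proj_def id_func_def)
    have 2: "fst (snd (ar s f)) = f" if "f \<in> Mor C" for f
      using eq that
      by (simp add: func_eq_on_def comp_func_def elements_proj_def id_func_def split_def)
    have "snd (ob s a) \<in> ob X a" if "a \<in> Obj C" for a
      using S.ob_in_Obj[OF that] 1[OF that] by (auto simp: elements_def)
    moreover have "app (ar X f) (snd (ob s a)) = snd (ob s b)" if "f \<in> hom C a b" for a b f
    proof -
      have "f \<in> Mor C" using that by (simp add: hom_def)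
      from 2[OF this] S.ar_in_hom[OF that] show ?thesis
        by (cases "ob s a"; cases "ob s b") (auto simp: elements_def hom_def)
    qed
    ultimately show "\<exists>t. (\<forall>a\<in>Obj C. t a \<in> ob X a) \<and>
        (\<forall>a b. \<forall>f\<in>hom C a b. app (ar X f) (t a) = t b)"
      by (intro exI[of _ "\<lambda>a. snd (ob s a)"]) auto
  next
    assume "\<exists>t. (\<forall>a\<in>Obj C. t a \<in> ob X a) \<and>
        (\<forall>a b. \<forall>f\<in>hom C a b. app (ar X f) (t a) = t b)"
    then obtain t where t: "\<And>a. a \<in> Obj C \<Longrightarrow> t a \<in> ob X a"
      and nat: "\<And>a b f. f \<in> hom C a b \<Longrightarrow> app (ar X f) (t a) = t b" by blast
    define s where "s = \<lparr>ob = (\<lambda>a. (a, t a)),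
      ar = (\<lambda>f. ((Dom C f, t (Dom C f)), f, (Cod C f, t (Cod C f))))\<rparr>"
    have "is_functor C (elements C X) s"
    proof
      show "ob s a \<in> Obj (elements C X)" if "a \<in> Obj C" for a
        using that t by (simp add: s_def elements_def)
      show "ar s f \<in> hom (elements C X) (ob s a) (ob s b)" if "f \<in> hom C a b" for f a b
        using that nat[OF that] t X.C.hom_objs[OF that]
        by (auto simp: s_def elements_def hom_def)
      show "ar s (Ide C a) = Ide (elements C X) (ob s a)" if "a \<in> Obj C" for a
        using X.C.Ide_in_hom[OF that] by (simp add: s_def elements_def hom_def)
      show "ar s (Cmp C g f) = Cmp (elements C X) (ar s g) (ar s f)"
        if "f \<in> hom C a b" "g \<in> hom C b c" for f g a b c
        using X.C.Cmp_in_hom[OF that] that by (simp add: s_def elements_def hom_def)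
    qed
    moreover have "func_eq_on C (comp_func elements_proj s) id_func"
      by (simp add: func_eq_on_def comp_func_def elements_proj_def id_func_def s_def)
    ultimately show "has_global_section C X" by (auto simp: has_global_section_def)
  qed
qed

text \<open>Compatibility of the points pushed forward is functoriality of \<open>X\<close> applied
  to the cone equation.\<close>

lemma id_cone_imp_has_global_section:
  assumes X: "is_functor C Set_cat X" and ne: "\<And>c. c \<in> Obj C \<Longrightarrow> ob X c \<noteq> {}"
    and cone: "id_cone C c \<tau>"
  shows "has_global_section C X"
proof -
  interpret X: is_functor C Set_cat X by fact
  obtain x where x: "x \<in> ob X c" using cone ne[of c] by (auto simp: id_cone_def)
  have \<tau>: "\<tau> a \<in> hom C c a" if "a \<in> Obj C" for a using cone that by (simp add: id_cone_def)
  have nat: "Cmp C f (\<tau> a) = \<tau> b" if "f \<in> hom C a b" for f a b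
    using cone that by (simp add: id_cone_def)
  have "app (ar X (\<tau> a)) x \<in> ob X a" if "a \<in> Obj C" for a
    using X.ar_in_hom[OF \<tau>[OF that]] x by (auto simp: Set_cat_def hom_def)
  moreover have "app (ar X f) (app (ar X (\<tau> a)) x) = app (ar X (\<tau> b)) x"
    if f: "f \<in> hom C a b" for f a b
  proof -
    have a: "\<tau> a \<in> hom C c a" using \<tau> X.C.hom_objs(1)[OF f] .
    have "ar X (\<tau> b) = Cmp Set_cat (ar X f) (ar X (\<tau> a))"
      using X.ar_Cmp[OF a f] nat[OF f] by simp
    then show ?thesis using X.ar_in_hom[OF a] x by (simp add: Set_cat_def hom_def)
  qed
  ultimately show ?thesis
    unfolding has_global_section_iff[OF X] by (intro exI[of _ "\<lambda>a. app (ar X (\<tau> a)) x"]) auto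
qed

section \<open>The coproduct of the representable functors\<close>

text \<open>The coproduct of all representable functors, transported to the universe along an injection
  \<open>e\<close> of the morphisms.\<close>

definition arrows_into ::
    "('o, 'm) cat \<Rightarrow> ('m \<Rightarrow> 'u) \<Rightarrow> ('o, 'm, 'u set, 'u set_map) func" where
  "arrows_into C e = (let P = (\<lambda>a. e ` {f \<in> Mor C. Cod C f = a}) in
    \<lparr>ob = P, ar = (\<lambda>f. Set_Map (P (Dom C f)) (P (Cod C f))
      (\<lambda>x\<in>P (Dom C f). e (Cmp C f (inv_into (Mor C) e x))))\<rparr>)"

lemma ob_arrows_into: "ob (arrows_into C e) a = e ` {f \<in> Mor C. Cod C f = a}"
  by (simp add: arrows_into_def)

text \<open>Injectivity lets \<open>inv_into\<close> undo \<open>e\<close>, so the encoded map is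
  postcomposition with \<open>f\<close>.\<close>

lemma app_arrows_into:
  assumes "inj_on e (Mor C)" "f \<in> hom C a b" "g \<in> hom C c a"
  shows "app (ar (arrows_into C e) f) (e g) = e (Cmp C f g)"
  using assms by (auto simp: arrows_into_def Let_def hom_def)

lemma (in category) is_functor_arrows_into:
  assumes inj: "inj_on e (Mor C)"
  shows "is_functor C Set_cat (arrows_into C e)" (is "is_functor _ _ ?X")
proof -
  interpret S: category Set_cat by (rule category_Set_cat)
  have app: "app (ar ?X f) (e g) = e (Cmp C f g)" if "f \<in> hom C a b" "g \<in> hom C c a" for f g a b c
    using app_arrows_into[OF inj that] .
  have ar: "source (ar ?X f) = ob ?X a" "target (ar ?X f) = ob ?X b"
    "app (ar ?X f) \<in> extensional (ob ?X a)" if "f \<in> hom C a b" for f a b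
    using that by (auto simp: arrows_into_def Let_def hom_def)
  \<comment> \<open>With \<open>elem\<close> and \<open>mem\<close>, points of the functor are
    handled as arrows; the functor laws then reduce to the unit and associativity laws of
    \<open>C\<close>.\<close>
  have elem: "\<exists>g d. g \<in> hom C d a \<and> x = e g" if "x \<in> ob ?X a" for x a
    using that by (auto simp: ob_arrows_into hom_def)
  have mem: "e g \<in> ob ?X a" if "g \<in> hom C d a" for g d a
    using that by (auto simp: ob_arrows_into hom_def)
  have hom: "ar ?X f \<in> hom Set_cat (ob ?X a) (ob ?X b)" if f: "f \<in> hom C a b" for f a b
  proof -
    have "app (ar ?X f) x \<in> ob ?X b" if x: "x \<in> ob ?X a" for x
      using elem[OF x] f app[OF f] mem[OF Cmp_in_hom[OF _ f]] by auto
    then show ?thesis using ar[OF f] by (simp add: hom_def Set_cat_def PiE_iff)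
  qed
  show ?thesis
  proof
    show "ob ?X a \<in> Obj Set_cat" if "a \<in> Obj C" for a by (simp add: Set_cat_def)
    show "ar ?X f \<in> hom Set_cat (ob ?X a) (ob ?X b)" if "f \<in> hom C a b" for f a b
      by (rule hom[OF that])
    show "ar ?X (Ide C a) = Ide Set_cat (ob ?X a)" if a: "a \<in> Obj C" for a
    proof (rule set_map.expand, intro conjI)
      note i = Ide_in_hom[OF a]
      show "source (ar ?X (Ide C a)) = source (Ide Set_cat (ob ?X a))"
        "target (ar ?X (Ide C a)) = target (Ide Set_cat (ob ?X a))"
        using ar[OF i] by (simp_all add: Set_cat_def)
      have "app (ar ?X (Ide C a)) x = x" if x: "x \<in> ob ?X a" for x
        using elem[OF x] app[OF i] Cmp_Ide_left by auto
      then show "app (ar ?X (Ide C a)) = app (Ide Set_cat (ob ?X a))"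
        \<comment> \<open>Both maps are extensional on the same source, so agreement on its points
          suffices.\<close>
        using ar(3)[OF i] by (intro extensionalityI[of _ "ob ?X a"]) (auto simp: Set_cat_def)
    qed
    show "ar ?X (Cmp C g f) = Cmp Set_cat (ar ?X g) (ar ?X f)"
      if f: "f \<in> hom C a b" and g: "g \<in> hom C b c" for f g a b c
    proof (rule set_map.expand, intro conjI)
      note gf = Cmp_in_hom[OF f g]
      show "source (ar ?X (Cmp C g f)) = source (Cmp Set_cat (ar ?X g) (ar ?X f))"
        "target (ar ?X (Cmp C g f)) = target (Cmp Set_cat (ar ?X g) (ar ?X f))"
        using ar[OF gf] ar[OF f] ar[OF g] by (simp_all add: Set_cat_def)
      have "app (ar ?X (Cmp C g f)) x = app (ar ?X g) (app (ar ?X f) x)"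
        if x: "x \<in> ob ?X a" for x
      proof -
        obtain h d where h: "h \<in> hom C d a" "x = e h" using elem[OF x] by blast
        show ?thesis
          using app[OF gf h(1)] app[OF f h(1)] app[OF g Cmp_in_hom[OF h(1) f]]
            Cmp_assoc[OF h(1) f g] h(2) by simp
      qed
      then show "app (ar ?X (Cmp C g f)) = app (Cmp Set_cat (ar ?X g) (ar ?X f))"
        using ar(3)[OF gf] ar(1)[OF f]
        by (intro extensionalityI[of _ "ob ?X a"]) (auto simp: Set_cat_def)
    qed
  qed
qed

section \<open>From a section to a cone\<close>

text \<open>Induction along a zigzag: equality is symmetric, so the direction of each arrow is
  immaterial.\<close>

lemma connected_cat_constant:
  assumes conn: "connected_cat C" and "a \<in> Obj C" "b \<in> Obj C"
    and const: "\<And>f a b. f \<in> hom C a b \<Longrightarrow> k a = k b"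
  shows "k a = k b"
proof -
  have "(a, b) \<in> (arrow_rel C \<union> (arrow_rel C)\<inverse>)\<^sup>*"
    using assms by (auto simp: connected_cat_def)
  then show ?thesis
    by (induction rule: rtrancl_induct) (auto simp: arrow_rel_def dest: const)
qed

lemma (in category) id_cone_if_section_arrows_into:
  assumes inj: "inj_on e (Mor C)" and conn: "connected_cat C"
    and sec: "has_global_section C (arrows_into C e)"
  shows "\<exists>c \<tau>. id_cone C c \<tau>"
proof -
  obtain t where t: "\<And>a. a \<in> Obj C \<Longrightarrow> t a \<in> ob (arrows_into C e) a"
    and nat: "\<And>a b f. f \<in> hom C a b \<Longrightarrow> app (ar (arrows_into C e) f) (t a) = t b"
    using sec unfolding has_global_section_iff[OF is_functor_arrows_into[OF inj]] by blast
  \<comment> \<open>Decoding \<open>t a\<close> gives an arrow into \<open>a\<close> whose domain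
    may a priori depend on \<open>a\<close>.\<close>
  have "\<exists>\<tau>. \<forall>a\<in>Obj C. \<tau> a \<in> Mor C \<and> Cod C (\<tau> a) = a \<and> t a = e (\<tau> a)"
    by (rule bchoice) (use t in \<open>auto simp: ob_arrows_into\<close>)
  then obtain \<tau> where \<tau>: "\<And>a. a \<in> Obj C \<Longrightarrow> \<tau> a \<in> hom C (Dom C (\<tau> a)) a"
    and te: "\<And>a. a \<in> Obj C \<Longrightarrow> t a = e (\<tau> a)" by (auto simp: hom_def)
  have \<tau>_nat: "Cmp C f (\<tau> a) = \<tau> b" if f: "f \<in> hom C a b" for f a b
  proof -
    note ab = hom_objs[OF f]
    have "e (Cmp C f (\<tau> a)) = e (\<tau> b)"
      using nat[OF f] app_arrows_into[OF inj f \<tau>[OF ab(1)]] te ab by simp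
    then show ?thesis
      using inj Cmp_in_hom[OF \<tau>[OF ab(1)] f] \<tau>[OF ab(2)] by (auto simp: hom_def dest: inj_onD)
  qed
  \<comment> \<open>Composing with \<open>f\<close> on the left keeps the domain of
    \<open>\<tau> a\<close>, and the composite is \<open>\<tau> b\<close>.\<close>
  have dom: "Dom C (\<tau> a) = Dom C (\<tau> b)" if f: "f \<in> hom C a b" for f a b
    using Cmp_in_hom[OF \<tau>[OF hom_objs(1)[OF f]] f] \<tau>_nat[OF f] by (simp add: hom_def)
  obtain a0 where a0: "a0 \<in> Obj C" using conn by (auto simp: connected_cat_def)
  have "\<tau> a \<in> hom C (Dom C (\<tau> a0)) a" if a: "a \<in> Obj C" for a
  proof -
    have "Dom C (\<tau> a) = Dom C (\<tau> a0)"
      by (rule connected_cat_constant[OF conn a a0, of "\<lambda>a. Dom C (\<tau> a)"]) (rule dom)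
    with \<tau>[OF a] show ?thesis by simp
  qed
  then have "id_cone C (Dom C (\<tau> a0)) \<tau>"
    using \<tau>_nat hom_objs(1)[OF \<tau>[OF a0]] by (simp add: id_cone_def)
  then show ?thesis by blast
qed

theorem theorem7p11:
  fixes C :: "('o, 'm) cat"
  assumes "category C" and "finite_cat C" and "connected_cat C" and "acyclic_cat C"
    and "infinite (UNIV :: 'u set)"
  shows "dcat C = 0 \<longleftrightarrow>
    (\<forall>X :: ('o, 'm, 'u set, 'u set_map) func.
      is_functor C Set_cat X \<and> (\<forall>c\<in>Obj C. ob X c \<noteq> {}) \<longrightarrow> has_global_section C X)"
proof -
  interpret category C by fact
  show ?thesis
    unfolding dcat_eq_0_iff dcat_le_0_iff_id_cone
  proof
    assume "\<exists>c \<tau>. id_cone C c \<tau>"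
    then show "\<forall>X :: ('o, 'm, 'u set, 'u set_map) func.
        is_functor C Set_cat X \<and> (\<forall>c\<in>Obj C. ob X c \<noteq> {}) \<longrightarrow> has_global_section C X"
      by (auto intro: id_cone_imp_has_global_section)
  next
    assume sec: "\<forall>X :: ('o, 'm, 'u set, 'u set_map) func.
        is_functor C Set_cat X \<and> (\<forall>c\<in>Obj C. ob X c \<noteq> {}) \<longrightarrow> has_global_section C X"
    \<comment> \<open>Finiteness of \<open>C\<close> enters here: the morphisms fit injectively into
      the infinite universe, so the functor of arrows takes values in sets over
      \<open>'u\<close>.\<close>
    obtain B :: "'u set" where B: "finite B" "card B = card (Mor C)"
      using infinite_arbitrarily_large[OF assms(5)] by blast
    then obtain e where e: "bij_betw e (Mor C) B"
      using finite_same_card_bij assms(2) unfolding finite_cat_def by metis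
    then have inj: "inj_on e (Mor C)" by (rule bij_betw_imp_inj_on)
    have "ob (arrows_into C e) c \<noteq> {}" if "c \<in> Obj C" for c
      using Ide_in_hom[OF that] by (auto simp: ob_arrows_into hom_def)
    then have "has_global_section C (arrows_into C e)"
      using sec is_functor_arrows_into[OF inj] by blast
    then show "\<exists>c \<tau>. id_cone C c \<tau>"
      by (rule id_cone_if_section_arrows_into[OF inj assms(3)])
  qed
qed

end
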